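(* Let $\mathcal{G} = (\mathcal{U},\mathcal{V},\mathcal{E})$ be the bipartite graph, $\mathcal{G}_C = (\mathcal{V},\mathcal{E}_C)$ the conflict graph, $F(S) = |\Gamma(S)|$ the covering function, and $\mathcal{M}$ the family of independent sets of $\mathcal{G}_C$, all as defined in the context. Let $\Delta$ be the maximum degree of any node in $\mathcal{G}_C$. Consider the problem $$\max_{S \subseteq \mathcal{V}} F(S) \quad \text{subject to } S \in \mathcal{M},$$ let $S^*$ be an optimal solution, and let $S_g$ be any solution returned by the greedy algorithm described in the context (with arbitrary tie-breaking). Then $$F(S_g) \;\geq\; \frac{1}{\Delta+2}\, F(S^* ).$$ Moreover, if $\Gamma(b) \cap \Gamma(b') = \emptyset$ for all distinct $b, b' \in \mathcal{V}$, then $$F(S_g) \;\geq\; \frac{1}{\Delta+1}\, F(S^* ).$$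
   Context: Let $\mathcal{B}$ be a finite set (of image patches) and $K$ a positive integer. $\mathcal{G} = (\mathcal{U},\mathcal{V},\mathcal{E})$ is a bipartite graph whose two sides $\mathcal{U}$ and $\mathcal{V}$ are disjoint copies of $\mathcal{B}$, in which each $b \in \mathcal{V}$ is adjacent to at most $K$ elements of $\mathcal{U}$ (the copies in $\mathcal{U}$ of its nearest neighbors lying in $\mathcal{B}$); the adjacency relation is otherwise arbitrary. For $S \subseteq \mathcal{V}$, the neighborhood of $S$ in $\mathcal{G}$ is $$\Gamma(S) = \{u \in \mathcal{U} \mid (b,u) \in \mathcal{E} \text{ for some } b \in S\},$$ and $\Gamma(b) = \Gamma(\{b\})$ for $b \in \mathcal{V}$. The covering function is $F(S) = |\Gamma(S)|$. The conflict graph $\mathcal{G}_C = (\mathcal{V},\mathcal{E}_C)$ is a simple undirected graph (no loops) on the node set $\mathcal{V}$; an edge between $b$ and $b'$ encodes that $b$ and $b'$ may not both be selected. The feasible family is the family of all independent sets of $\mathcal{G}_C$: $$\mathcal{M} = \{S \subseteq \mathcal{V} \mid \text{for all } b,b' \in S \text{ there is no edge } (b,b') \in \mathcal{E}_C\}.$$ Greedy algorithm: start with $S^0 = \emptyset$ and with all elements of $\mathcal{V}$ available. In iteration $t = 1,2,\dots$, choose among the currently available elements (those neither selected nor deleted so far) an element $b$ maximizing the marginal gain $|\Gamma(b) \setminus \Gamma(S^{t-1})|$, set $S^t = S^{t-1} \cup \{b\}$, and delete $b$ and all of its neighbors in $\mathcal{G}_C$ from the set of available elements. Stop when no available elements remain,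 and return the final set $S_g$. *)

theory Defs
  imports Complex_Main
begin

text \<open>
  A bipartite graph with sides \<open>U\<close> and \<open>V\<close> is given by a relation \<open>E \<subseteq> V \<times> U\<close>;
  pairs are written with the endpoint in \<open>V\<close> first.
\<close>

definition nbhd :: "'u set \<Rightarrow> ('v \<times> 'u) set \<Rightarrow> 'v set \<Rightarrow> 'u set" where
  "nbhd U E S = {u \<in> U. \<exists>b\<in>S. (b, u) \<in> E}"

definition covering :: "'u set \<Rightarrow> ('v \<times> 'u) set \<Rightarrow> 'v set \<Rightarrow> nat" where
  "covering U E S = card (nbhd U E S)"

text \<open>Edges of a simple undirected graph are two-element sets of nodes.\<close>

definition simple_graph :: "'v set \<Rightarrow> 'v set set \<Rightarrow> bool" where
  "simple_graph V EC \<longleftrightarrow> (\<forall>e\<in>EC. e \<subseteq> V \<and> card e = 2)"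

definition conflicts :: "'v set \<Rightarrow> 'v set set \<Rightarrow> 'v \<Rightarrow> 'v set" where
  "conflicts V EC b = {b' \<in> V. {b, b'} \<in> EC}"

text \<open>For \<open>V = {}\<close> the maximum is an unspecified natural number.\<close>

definition max_degree :: "'v set \<Rightarrow> 'v set set \<Rightarrow> nat" where
  "max_degree V EC = Max ((\<lambda>b. card (conflicts V EC b)) ` V)"

definition feasible :: "'v set \<Rightarrow> 'v set set \<Rightarrow> 'v set set" where
  "feasible V EC = {S. S \<subseteq> V \<and> (\<forall>b\<in>S. \<forall>b'\<in>S. {b, b'} \<notin> EC)}"

definition optimal_solution ::
    "'u set \<Rightarrow> 'v set \<Rightarrow> ('v \<times> 'u) set \<Rightarrow> 'v set set \<Rightarrow> 'v set \<Rightarrow> bool" where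
  "optimal_solution U V E EC S \<longleftrightarrow>
     is_arg_max (covering U E) (\<lambda>T. T \<in> feasible V EC) S"

text \<open>
  A state \<open>(S, A)\<close> of the greedy algorithm consists of the selected elements \<open>S\<close> and
  the available elements \<open>A\<close>. The step is a relation, as ties are broken arbitrarily.
\<close>

inductive greedy_step ::
    "'u set \<Rightarrow> 'v set \<Rightarrow> ('v \<times> 'u) set \<Rightarrow> 'v set set \<Rightarrow>
     'v set \<times> 'v set \<Rightarrow> 'v set \<times> 'v set \<Rightarrow> bool"
  for U V E EC where
  "is_arg_max (\<lambda>c. card (nbhd U E {c} - nbhd U E S)) (\<lambda>c. c \<in> A) b \<Longrightarrow>
   greedy_step U V E EC (S, A) (S \<union> {b}, A - ({b} \<union> conflicts V EC b))"

definition greedy_solution ::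
    "'u set \<Rightarrow> 'v set \<Rightarrow> ('v \<times> 'u) set \<Rightarrow> 'v set set \<Rightarrow> 'v set \<Rightarrow> bool" where
  "greedy_solution U V E EC S \<longleftrightarrow> (greedy_step U V E EC)\<^sup>*\<^sup>* ({}, V) (S, {})"

end

theory Submission
  imports Defs
begin

text \<open>
  When the greedy algorithm selects \<open>b\<close>, at most \<open>\<Delta> + 1\<close> elements stop being available, and
  each of them has marginal gain at most that of \<open>b\<close>. Summed over all iterations, the deleted
  elements, hence all of \<open>V\<close>, cover at most \<open>(\<Delta> + 1) F(S\<^sub>g)\<close> nodes outside \<open>\<Gamma>(S\<^sub>g)\<close>. The nodes in
  \<open>\<Gamma>(S\<^sub>g)\<close> contribute the additional \<open>F(S\<^sub>g)\<close>. If the neighborhoods are pairwise disjoint, the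
  marginal gain of an available element is its whole neighborhood, so this extra term is not
  needed.
\<close>

lemma finite_nbhd: "finite U \<Longrightarrow> finite (nbhd U E S)"
  by (simp add: nbhd_def)

lemma nbhd_Un: "nbhd U E (S \<union> T) = nbhd U E S \<union> nbhd U E T"
  by (auto simp: nbhd_def)

lemma nbhd_mono: "S \<subseteq> T \<Longrightarrow> nbhd U E S \<subseteq> nbhd U E T"
  by (auto simp: nbhd_def)

lemma nbhd_eq_UN: "nbhd U E S = (\<Union>b\<in>S. nbhd U E {b})"
  by (auto simp: nbhd_def)

lemma card_conflicts_le_max_degree:
  "finite V \<Longrightarrow> b \<in> V \<Longrightarrow> card (conflicts V EC b) \<le> max_degree V EC"
  by (simp add: max_degree_def)

text \<open>One iteration of the charging argument: what the elements deleted together with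
  \<open>b\<close> newly cover is paid for by \<open>\<Delta> + 1\<close> times the growth of
  \<open>F\<close>. With the old value of \<open>F\<close> added on the left instead of subtracted
  on the right, the bound telescopes over \<open>nat\<close>.\<close>

lemma card_deleted_gain_le:
  assumes "finite U" "finite V" "A \<subseteq> V"
    and b: "is_arg_max (\<lambda>c. card (nbhd U E {c} - nbhd U E S)) (\<lambda>c. c \<in> A) b"
  shows "card (nbhd U E (A \<inter> ({b} \<union> conflicts V EC b)) - nbhd U E S)
           + (max_degree V EC + 1) * covering U E S
         \<le> (max_degree V EC + 1) * covering U E (S \<union> {b})"
proof -
  let ?d = "max_degree V EC + 1"
  let ?D = "A \<inter> ({b} \<union> conflicts V EC b)"
  let ?g = "card (nbhd U E {b} - nbhd U E S)"
  have "b \<in> V" using b \<open>A \<subseteq> V\<close> by (auto simp: is_arg_max_def)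
  have fin: "finite (conflicts V EC b)"
    using \<open>finite V\<close> by (simp add: conflicts_def)
  \<comment> \<open>The \<open>1\<close> in \<open>?d\<close> accounts for \<open>b\<close> itself,
    which is deleted along with its conflicts.\<close>
  have "card ?D \<le> card (insert b (conflicts V EC b))"
    using fin by (intro card_mono) auto
  also have "\<dots> \<le> Suc (card (conflicts V EC b))"
    by (rule card_insert_le_m1) auto
  also have "\<dots> \<le> ?d"
    using card_conflicts_le_max_degree[OF \<open>finite V\<close> \<open>b \<in> V\<close>] by simp
  finally have card_D: "card ?D \<le> ?d" .
  have finD: "finite ?D" using fin by simp
  have "card (nbhd U E ?D - nbhd U E S) = card (\<Union>c\<in>?D. nbhd U E {c} - nbhd U E S)"
    by (subst nbhd_eq_UN) (rule arg_cong[where f = card], blast)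
  also have "\<dots> \<le> (\<Sum>c\<in>?D. card (nbhd U E {c} - nbhd U E S))"
    by (rule card_UN_le[OF finD])
  \<comment> \<open>Every element of \<open>?D\<close> was still available, so the greedy choice of
    \<open>b\<close> bounds its gain by \<open>?g\<close>.\<close>
  also have "\<dots> \<le> card ?D * ?g"
    using sum_bounded_above[of ?D "\<lambda>c. card (nbhd U E {c} - nbhd U E S)" ?g] b
    by (force simp: is_arg_max_linorder)
  also have "\<dots> \<le> ?d * ?g"
    using card_D by (rule mult_right_mono) simp
  finally have gain: "card (nbhd U E ?D - nbhd U E S) \<le> ?d * ?g" .
  have "covering U E (S \<union> {b}) = card (nbhd U E S \<union> (nbhd U E {b} - nbhd U E S))"
    unfolding covering_def nbhd_Un by (rule arg_cong[where f = card]) blast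
  also have "\<dots> = covering U E S + ?g"
    unfolding covering_def using \<open>finite U\<close>
    by (intro card_Un_disjoint) (auto simp: finite_nbhd)
  finally have "?d * covering U E (S \<union> {b}) = ?d * covering U E S + ?d * ?g"
    by (simp only: distrib_left)
  with gain show ?thesis by linarith
qed

text \<open>\<open>V - A\<close> collects the elements selected or deleted so far; when the run
  stops it is all of \<open>V\<close>.\<close>

lemma greedy_reachable_bounds:
  assumes "finite U" "finite V"
    and "(greedy_step U V E EC)\<^sup>*\<^sup>* ({}, V) (S, A)"
  shows "card (nbhd U E (V - A) - nbhd U E S) \<le> (max_degree V EC + 1) * covering U E S"
    and "\<forall>b\<in>V. \<forall>b'\<in>V. b \<noteq> b' \<longrightarrow> nbhd U E {b} \<inter> nbhd U E {b'} = {} \<Longrightarrow>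
      covering U E (V - A) \<le> (max_degree V EC + 1) * covering U E S"
proof -
  let ?d = "max_degree V EC + 1"
  let ?disj = "\<forall>b\<in>V. \<forall>b'\<in>V. b \<noteq> b' \<longrightarrow> nbhd U E {b} \<inter> nbhd U E {b'} = {}"
  have "A \<subseteq> V \<and> S \<subseteq> V - A \<and> card (nbhd U E (V - A) - nbhd U E S) \<le> ?d * covering U E S
      \<and> (?disj \<longrightarrow> covering U E (V - A) \<le> ?d * covering U E S)"
    using assms(3)
  proof (induction rule: rtranclp_induct2)
    case refl
    show ?case by (simp add: nbhd_def covering_def)
  next
    case (step S A S' A')
    from step.hyps(2) obtain b
      where b: "is_arg_max (\<lambda>c. card (nbhd U E {c} - nbhd U E S)) (\<lambda>c. c \<in> A) b"
        and S': "S' = S \<union> {b}" and A': "A' = A - ({b} \<union> conflicts V EC b)"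
      by (auto elim: greedy_step.cases)
    let ?D = "A \<inter> ({b} \<union> conflicts V EC b)"
    have AV: "A \<subseteq> V" and SV: "S \<subseteq> V - A" using step.IH by auto
    have bA: "b \<in> A" using b by (simp add: is_arg_max_def)
    have gain: "card (nbhd U E ?D - nbhd U E S) + ?d * covering U E S \<le> ?d * covering U E S'"
      unfolding S' by (rule card_deleted_gain_le[OF assms(1,2) AV b])
    have "V - A' = (V - A) \<union> ?D" using AV A' by auto
    then have nb: "nbhd U E (V - A') = nbhd U E (V - A) \<union> nbhd U E ?D"
      by (simp only: nbhd_Un)
    \<comment> \<open>Enlarging \<open>S\<close> to \<open>S'\<close> only shrinks what is left
      uncovered, so both parts may be measured against the old \<open>S\<close>, where the induction
      hypothesis and \<open>gain\<close> apply.\<close>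
    have "card (nbhd U E (V - A') - nbhd U E S')
        \<le> card ((nbhd U E (V - A) - nbhd U E S) \<union> (nbhd U E ?D - nbhd U E S))"
      using \<open>finite U\<close> unfolding nb S' nbhd_Un
      by (intro card_mono) (auto simp: finite_nbhd)
    also have "\<dots> \<le> card (nbhd U E (V - A) - nbhd U E S) + card (nbhd U E ?D - nbhd U E S)"
      by (rule card_Un_le)
    also have "\<dots> \<le> ?d * covering U E S'" using step.IH gain by linarith
    finally have bound: "card (nbhd U E (V - A') - nbhd U E S') \<le> ?d * covering U E S'" .
    have disj_bound: "covering U E (V - A') \<le> ?d * covering U E S'" if disj: ?disj
    proof -
      \<comment> \<open>Disjointness makes removing \<open>\<Gamma>(S)\<close> from the neighborhood
        of \<open>?D\<close> harmless, so \<open>gain\<close> bounds that whole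
        neighborhood.\<close>
      have "nbhd U E {c} \<inter> nbhd U E {s} = {}" if "c \<in> ?D" "s \<in> S" for c s
      proof -
        have "c \<in> V" "s \<in> V" "c \<noteq> s" using that AV SV by auto
        with disj show ?thesis by blast
      qed
      then have "nbhd U E ?D - nbhd U E S = nbhd U E ?D"
        by (subst (1 3) nbhd_eq_UN, subst nbhd_eq_UN[of U E S]) blast
      then have "covering U E (V - A') \<le> covering U E (V - A) + card (nbhd U E ?D - nbhd U E S)"
        unfolding covering_def nb by (simp add: card_Un_le)
      with step.IH gain disj show ?thesis by linarith
    qed
    have "A' \<subseteq> V" "S' \<subseteq> V - A'" using AV SV bA S' A' by auto
    with bound disj_bound show ?case by blast
  qed
  then show "card (nbhd U E (V - A) - nbhd U E S) \<le> ?d * covering U E S"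
    and "?disj \<Longrightarrow> covering U E (V - A) \<le> ?d * covering U E S"
    by blast+
qed

theorem lemma1:
  fixes B :: "'b set" and K :: nat
    and U V :: "('b + 'b) set"
    and E :: "(('b + 'b) \<times> ('b + 'b)) set"
    and EC :: "('b + 'b) set set"
    and Sopt Sg :: "('b + 'b) set"
  assumes "finite B" and "K > 0"
    and "U = Inl ` B" and "V = Inr ` B"
    and "E \<subseteq> V \<times> U"
    and "\<forall>b\<in>V. card (nbhd U E {b}) \<le> K"
    and "simple_graph V EC"
    and "optimal_solution U V E EC Sopt"
    and "greedy_solution U V E EC Sg"
  shows "real (covering U E Sg)
           \<ge> 1 / (real (max_degree V EC) + 2) * real (covering U E Sopt)
       \<and> ((\<forall>b\<in>V. \<forall>b'\<in>V. b \<noteq> b' \<longrightarrow> nbhd U E {b} \<inter> nbhd U E {b'} = {}) \<longrightarrow>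
           real (covering U E Sg)
             \<ge> 1 / (real (max_degree V EC) + 1) * real (covering U E Sopt))"
proof -
  let ?d = "max_degree V EC"
  have fin: "finite U" "finite V" using assms(1,3,4) by auto
  have run: "(greedy_step U V E EC)\<^sup>*\<^sup>* ({}, V) (Sg, {})"
    using assms(9) by (simp add: greedy_solution_def)
  \<comment> \<open>Monotonicity of \<open>F\<close> replaces the optimum by all of
    \<open>V\<close>, to which the invariant applies at \<open>A = {}\<close>.\<close>
  have "Sopt \<subseteq> V"
    using assms(8) by (auto simp: optimal_solution_def is_arg_max_def feasible_def)
  then have opt: "covering U E Sopt \<le> covering U E V"
    unfolding covering_def by (intro card_mono finite_nbhd fin nbhd_mono)
  \<comment> \<open>The part of \<open>\<Gamma>(V)\<close> inside \<open>\<Gamma>(Sg)\<close> raises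
    the factor from \<open>\<Delta> + 1\<close> to \<open>\<Delta> + 2\<close>.\<close>
  have "covering U E V \<le> card ((nbhd U E V - nbhd U E Sg) \<union> nbhd U E Sg)"
    unfolding covering_def by (intro card_mono) (auto simp: finite_nbhd fin)
  also have "\<dots> \<le> card (nbhd U E V - nbhd U E Sg) + covering U E Sg"
    unfolding covering_def by (rule card_Un_le)
  also have "\<dots> \<le> (?d + 1) * covering U E Sg + covering U E Sg"
    using greedy_reachable_bounds(1)[OF fin run] by simp
  finally have "covering U E Sopt \<le> (?d + 2) * covering U E Sg"
    using opt by simp
  then have "real (covering U E Sopt) \<le> real ((?d + 2) * covering U E Sg)"
    by (rule of_nat_mono)
  then have general: "1 / (real ?d + 2) * real (covering U E Sopt) \<le> real (covering U E Sg)"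
    by (simp add: field_simps)
  have "1 / (real ?d + 1) * real (covering U E Sopt) \<le> real (covering U E Sg)"
    if "\<forall>b\<in>V. \<forall>b'\<in>V. b \<noteq> b' \<longrightarrow> nbhd U E {b} \<inter> nbhd U E {b'} = {}"
  proof -
    have "covering U E Sopt \<le> (?d + 1) * covering U E Sg"
      using greedy_reachable_bounds(2)[OF fin run that] opt by simp
    then have "real (covering U E Sopt) \<le> real ((?d + 1) * covering U E Sg)"
      by (rule of_nat_mono)
    then show ?thesis by (simp add: field_simps)
  qed
  with general show ?thesis by blast
qed

end
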